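(* Let ${\cal L}$ be a partial structure and $c$ a restriction. If $\widehat{{\tt sat}}({\cal L},c)$ is defined, then for every substitution $\sigma'$ with $\mathrm{dom}(\sigma')\supseteq\mathrm{fv}(c)$: ${\cal L}\models c\sigma'$ if and only if there is a substitution $\sigma\in\widehat{{\tt sat}}({\cal L},c)$ such that $\sigma'\geq\sigma$.
   Context: Predicates are objective or subjective; each predicate $p$ has a dual predicate $\overline{p}$ of the same kind with $\overline{\overline{p}}=p$. Atoms are $p(t_1,\ldots,t_n)$; in addition there are special objective atoms $\vec t\not\in S$ and their duals $\vec t\in S$, where $S$ is a finite set of tuples of ground terms. Restrictions: $c ::= p_O(t_1,\ldots,t_n) \mid \vec{x}\not\in S \mid \top \mid \bot \mid c_1 \wedge c_2 \mid c_1 \vee c_2 \mid \exists x.c$ ($p_O$ objective). Dual of restrictions: $\overline{p_O(\vec t)}=\overline{p_O}(\vec t)$, $\overline{\vec t\not\in S}=(\vec t\in S)$, $\overline\top=\bot$, $\overline\bot=\top$, $\overline{c_1\wedge c_2}=\overline{c_1}\vee\overline{c_2}$, $\overline{c_1\vee c_2}=\overline{c_1}\wedge\overline{c_2}$, $\overline{\exists x.c}=\forall x.(\top\supset\overline c)$. A partial structure ${\cal L}$ over a domain $\mathrm{D}$ of individuals (ground terms) is a total function $\rho_{\cal L}$ from ground atoms to $\{{\tt tt},{\tt ff},{\tt uu}\}$ with $\rho_{\cal L}(\overline P)=\overline{\rho_{\cal L}(P)}$ ($\overline{{\tt tt}}={\tt ff}$, $\overline{{\tt ff}}={\tt tt}$,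 $\overline{{\tt uu}}={\tt uu}$) and $\rho_{\cal L}(\vec t\not\in S)={\tt tt}$ iff $\vec t\notin S$ (else ${\tt ff}$). For closed restrictions: ${\cal L}\models P$ iff $\rho_{\cal L}(P)={\tt tt}$; ${\cal L}\models\top$; ${\cal L}\not\models\bot$; $\wedge,\vee$ as usual; ${\cal L}\models\exists x.c$ iff ${\cal L}\models c[t/x]$ for some $t\in\mathrm{D}$. Substitutions $\sigma$ map finitely many variables to ground terms; $\bullet$ is the empty substitution; $\sigma'\geq\sigma$ means $\mathrm{dom}(\sigma')\supseteq\mathrm{dom}(\sigma)$ and they agree on $\mathrm{dom}(\sigma)$; $\sigma_1+\sigma_2$ is the union of two substitutions (agreeing on common variables); $\sigma\backslash\{x\}$ is $\sigma$ with $x$ removed from its domain; for a set $A$ of substitutions, $\sigma+A=\{\sigma+\sigma_2:\sigma_2\in A\}$ and $A\backslash\{x\}=\{\sigma\backslash\{x\}:\sigma\in A\}$. Each objective predicate $p_O$ has a set $I(p_O)$ of input positions and a set $O(p_O)$ of output positions (for $\vec x\not\in S$ all positions are input). A function ${\tt sat}$ is given: for each structure ${\cal L}$ and objective atom $P=p_O(t_1,\ldots,t_n)$ whose arguments $t_k$, $k\in I(p_O)$, are ground, ${\tt sat}({\cal L},P)$ is a finite set of substitutions, each with domain containing $\bigcup_{j\in O(p_O)}\mathrm{fv}(t_j)$, such that for every substitution $\sigma'$ with $\mathrm{dom}(\sigma')\supseteq\mathrm{fv}(P)$, ${\cal L}\models P\sigma'$ iff there is $\sigma\in{\tt sat}({\cal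 L},P)$ with $\sigma'\geq\sigma$; otherwise ${\tt sat}({\cal L},P)$ is undefined (for ground $\vec t$, ${\tt sat}({\cal L},\vec t\not\in S)$ is $\{\bullet\}$ if $\vec t\notin S$ and $\{\}$ otherwise). The partial function $\widehat{{\tt sat}}$ on restrictions is: $\widehat{{\tt sat}}({\cal L},p_O(\vec t))={\tt sat}({\cal L},p_O(\vec t))$; $\widehat{{\tt sat}}({\cal L},\top)=\{\bullet\}$; $\widehat{{\tt sat}}({\cal L},\bot)=\{\}$; $\widehat{{\tt sat}}({\cal L},c_1\wedge c_2)=\bigcup_{\sigma_1\in\widehat{{\tt sat}}({\cal L},c_1)}(\sigma_1+\widehat{{\tt sat}}({\cal L},c_2\sigma_1))$; $\widehat{{\tt sat}}({\cal L},c_1\vee c_2)=\widehat{{\tt sat}}({\cal L},c_1)\cup\widehat{{\tt sat}}({\cal L},c_2)$; $\widehat{{\tt sat}}({\cal L},\exists x.c)=\widehat{{\tt sat}}({\cal L},c)\backslash\{x\}$; it is defined only when all the constituent calls are defined. *)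

theory Defs
  imports Main
begin

datatype ('f, 'v) trm = Var 'v | Fun 'f "('f, 'v) trm list"

text \<open>Tuples are lists. Predicates with \<open>objective\<close> false are the subjective ones. Argument positions
  are counted from 0; the modes \<open>inputs\<close>, \<open>outputs\<close> matter for objective predicates only.\<close>

record ('f, 'p) sig =
  farity :: "'f \<Rightarrow> nat"
  parity :: "'p \<Rightarrow> nat"
  objective :: "'p \<Rightarrow> bool"
  pdual :: "'p \<Rightarrow> 'p"
  inputs :: "'p \<Rightarrow> nat set"
  outputs :: "'p \<Rightarrow> nat set"

definition wf_sig :: "('f, 'p) sig \<Rightarrow> bool" where
  "wf_sig \<Sigma> \<longleftrightarrow>
    (\<forall>p. pdual \<Sigma> (pdual \<Sigma> p) = p \<and>
         (objective \<Sigma> (pdual \<Sigma> p) \<longleftrightarrow> objective \<Sigma> p) \<and>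
         parity \<Sigma> (pdual \<Sigma> p) = parity \<Sigma> p) \<and>
    (\<forall>p. objective \<Sigma> p \<longrightarrow>
         inputs \<Sigma> p \<subseteq> {..<parity \<Sigma> p} \<and> outputs \<Sigma> p \<subseteq> {..<parity \<Sigma> p})"

fun tfv :: "('f, 'v) trm \<Rightarrow> 'v set" where
  "tfv (Var x) = {x}"
| "tfv (Fun f ts) = (\<Union>t\<in>set ts. tfv t)"

fun wf_trm :: "('f, 'p) sig \<Rightarrow> ('f, 'v) trm \<Rightarrow> bool" where
  "wf_trm \<Sigma> (Var x) \<longleftrightarrow> True"
| "wf_trm \<Sigma> (Fun f ts) \<longleftrightarrow> length ts = farity \<Sigma> f \<and> (\<forall>t\<in>set ts. wf_trm \<Sigma> t)"

definition individuals :: "('f, 'p) sig \<Rightarrow> ('f, 'v) trm set" where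
  "individuals \<Sigma> = {t. wf_trm \<Sigma> t \<and> tfv t = {}}"


type_synonym ('f, 'v) subst = "'v \<rightharpoonup> ('f, 'v) trm"

definition is_subst :: "('f, 'p) sig \<Rightarrow> ('f, 'v) subst \<Rightarrow> bool" where
  "is_subst \<Sigma> \<sigma> \<longleftrightarrow> finite (dom \<sigma>) \<and> ran \<sigma> \<subseteq> individuals \<Sigma>"

primrec tsubst :: "('f, 'v) subst \<Rightarrow> ('f, 'v) trm \<Rightarrow> ('f, 'v) trm" where
  "tsubst \<sigma> (Var x) = (case \<sigma> x of None \<Rightarrow> Var x | Some t \<Rightarrow> t)"
| "tsubst \<sigma> (Fun f ts) = Fun f (map (tsubst \<sigma>) ts)"

text \<open>The sum of two substitutions is partial: it exists only if they agree on common variables.\<close>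

definition subst_plus :: "('f, 'v) subst \<Rightarrow> ('f, 'v) subst \<Rightarrow> ('f, 'v) subst option" where
  "subst_plus \<sigma>\<^sub>1 \<sigma>\<^sub>2 =
    (if \<forall>x \<in> dom \<sigma>\<^sub>1 \<inter> dom \<sigma>\<^sub>2. \<sigma>\<^sub>1 x = \<sigma>\<^sub>2 x then Some (\<sigma>\<^sub>1 ++ \<sigma>\<^sub>2) else None)"

definition subst_plus_set :: "('f, 'v) subst \<Rightarrow> ('f, 'v) subst set \<Rightarrow> ('f, 'v) subst set" where
  "subst_plus_set \<sigma> A = {\<tau>. \<exists>\<sigma>\<^sub>2\<in>A. subst_plus \<sigma> \<sigma>\<^sub>2 = Some \<tau>}"

definition subst_remove_set :: "('f, 'v) subst set \<Rightarrow> 'v \<Rightarrow> ('f, 'v) subst set" where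
  "subst_remove_set A x = (\<lambda>\<sigma>. \<sigma>(x := None)) ` A"


datatype ('p, 'f, 'v) atom =
    Pred 'p "('f, 'v) trm list"
  | NotIn "('f, 'v) trm list" "('f, 'v) trm list set"
  | In "('f, 'v) trm list" "('f, 'v) trm list set"

fun afv :: "('p, 'f, 'v) atom \<Rightarrow> 'v set" where
  "afv (Pred p ts) = (\<Union>t\<in>set ts. tfv t)"
| "afv (NotIn ts S) = (\<Union>t\<in>set ts. tfv t)"
| "afv (In ts S) = (\<Union>t\<in>set ts. tfv t)"

fun asubst :: "('f, 'v) subst \<Rightarrow> ('p, 'f, 'v) atom \<Rightarrow> ('p, 'f, 'v) atom" where
  "asubst \<sigma> (Pred p ts) = Pred p (map (tsubst \<sigma>) ts)"
| "asubst \<sigma> (NotIn ts S) = NotIn (map (tsubst \<sigma>) ts) S"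
| "asubst \<sigma> (In ts S) = In (map (tsubst \<sigma>) ts) S"

fun adual :: "('f, 'p) sig \<Rightarrow> ('p, 'f, 'v) atom \<Rightarrow> ('p, 'f, 'v) atom" where
  "adual \<Sigma> (Pred p ts) = Pred (pdual \<Sigma> p) ts"
| "adual \<Sigma> (NotIn ts S) = In ts S"
| "adual \<Sigma> (In ts S) = NotIn ts S"

fun wf_atom :: "('f, 'p) sig \<Rightarrow> ('p, 'f, 'v) atom \<Rightarrow> bool" where
  "wf_atom \<Sigma> (Pred p ts) \<longleftrightarrow> length ts = parity \<Sigma> p \<and> (\<forall>t\<in>set ts. wf_trm \<Sigma> t)"
| "wf_atom \<Sigma> (NotIn ts S) \<longleftrightarrow>
    (\<forall>t\<in>set ts. wf_trm \<Sigma> t) \<and> finite S \<and> (\<forall>us\<in>S. set us \<subseteq> individuals \<Sigma>)"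
| "wf_atom \<Sigma> (In ts S) \<longleftrightarrow>
    (\<forall>t\<in>set ts. wf_trm \<Sigma> t) \<and> finite S \<and> (\<forall>us\<in>S. set us \<subseteq> individuals \<Sigma>)"


datatype truth = TT | FF | UU

fun tdual :: "truth \<Rightarrow> truth" where
  "tdual TT = FF"
| "tdual FF = TT"
| "tdual UU = UU"

text \<open>Only the values of a structure at ground atoms over the signature are meaningful.\<close>

type_synonym ('p, 'f, 'v) struct = "('p, 'f, 'v) atom \<Rightarrow> truth"

definition partial_structure :: "('f, 'p) sig \<Rightarrow> ('p, 'f, 'v) struct \<Rightarrow> bool" where
  "partial_structure \<Sigma> L \<longleftrightarrow>
    (\<forall>P. wf_atom \<Sigma> P \<and> afv P = {} \<longrightarrow> L (adual \<Sigma> P) = tdual (L P)) \<and>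
    (\<forall>ts S. wf_atom \<Sigma> (NotIn ts S) \<and> afv (NotIn ts S :: ('p, 'f, 'v) atom) = {} \<longrightarrow>
       L (NotIn ts S) = (if ts \<notin> S then TT else FF))"


text \<open>The tuple in \<open>RNotIn\<close> consists of terms rather than variables, so that restrictions are closed
  under substitution.\<close>

datatype ('p, 'f, 'v) restr =
    RPred 'p "('f, 'v) trm list"
  | RNotIn "('f, 'v) trm list" "('f, 'v) trm list set"
  | RTop
  | RBot
  | RAnd "('p, 'f, 'v) restr" "('p, 'f, 'v) restr"
  | ROr "('p, 'f, 'v) restr" "('p, 'f, 'v) restr"
  | REx 'v "('p, 'f, 'v) restr"

primrec restriction :: "('f, 'p) sig \<Rightarrow> ('p, 'f, 'v) restr \<Rightarrow> bool" where
  "restriction \<Sigma> (RPred p ts) \<longleftrightarrow> objective \<Sigma> p \<and> wf_atom \<Sigma> (Pred p ts)"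
| "restriction \<Sigma> (RNotIn ts S) \<longleftrightarrow> wf_atom \<Sigma> (NotIn ts S)"
| "restriction \<Sigma> RTop \<longleftrightarrow> True"
| "restriction \<Sigma> RBot \<longleftrightarrow> True"
| "restriction \<Sigma> (RAnd c\<^sub>1 c\<^sub>2) \<longleftrightarrow> restriction \<Sigma> c\<^sub>1 \<and> restriction \<Sigma> c\<^sub>2"
| "restriction \<Sigma> (ROr c\<^sub>1 c\<^sub>2) \<longleftrightarrow> restriction \<Sigma> c\<^sub>1 \<and> restriction \<Sigma> c\<^sub>2"
| "restriction \<Sigma> (REx x c) \<longleftrightarrow> restriction \<Sigma> c"

primrec rfv :: "('p, 'f, 'v) restr \<Rightarrow> 'v set" where
  "rfv (RPred p ts) = (\<Union>t\<in>set ts. tfv t)"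
| "rfv (RNotIn ts S) = (\<Union>t\<in>set ts. tfv t)"
| "rfv RTop = {}"
| "rfv RBot = {}"
| "rfv (RAnd c\<^sub>1 c\<^sub>2) = rfv c\<^sub>1 \<union> rfv c\<^sub>2"
| "rfv (ROr c\<^sub>1 c\<^sub>2) = rfv c\<^sub>1 \<union> rfv c\<^sub>2"
| "rfv (REx x c) = rfv c - {x}"

text \<open>Substitutions are ground, so no bound variable can capture anything.\<close>

primrec rsubst :: "('f, 'v) subst \<Rightarrow> ('p, 'f, 'v) restr \<Rightarrow> ('p, 'f, 'v) restr" where
  "rsubst \<sigma> (RPred p ts) = RPred p (map (tsubst \<sigma>) ts)"
| "rsubst \<sigma> (RNotIn ts S) = RNotIn (map (tsubst \<sigma>) ts) S"
| "rsubst \<sigma> RTop = RTop"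
| "rsubst \<sigma> RBot = RBot"
| "rsubst \<sigma> (RAnd c\<^sub>1 c\<^sub>2) = RAnd (rsubst \<sigma> c\<^sub>1) (rsubst \<sigma> c\<^sub>2)"
| "rsubst \<sigma> (ROr c\<^sub>1 c\<^sub>2) = ROr (rsubst \<sigma> c\<^sub>1) (rsubst \<sigma> c\<^sub>2)"
| "rsubst \<sigma> (REx x c) = REx x (rsubst (\<sigma>(x := None)) c)"

text \<open>Termination measure for the two recursions below, which recurse on substitution instances.\<close>

primrec rdepth :: "('p, 'f, 'v) restr \<Rightarrow> nat" where
  "rdepth (RPred p ts) = 0"
| "rdepth (RNotIn ts S) = 0"
| "rdepth RTop = 0"
| "rdepth RBot = 0"
| "rdepth (RAnd c\<^sub>1 c\<^sub>2) = Suc (rdepth c\<^sub>1 + rdepth c\<^sub>2)"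
| "rdepth (ROr c\<^sub>1 c\<^sub>2) = Suc (rdepth c\<^sub>1 + rdepth c\<^sub>2)"
| "rdepth (REx x c) = Suc (rdepth c)"

lemma rdepth_rsubst [simp]: "rdepth (rsubst \<sigma> c) = rdepth c"
  by (induction c arbitrary: \<sigma>) auto

function models :: "('f, 'p) sig \<Rightarrow> ('p, 'f, 'v) struct \<Rightarrow> ('p, 'f, 'v) restr \<Rightarrow> bool" where
  "models \<Sigma> L (RPred p ts) \<longleftrightarrow> L (Pred p ts) = TT"
| "models \<Sigma> L (RNotIn ts S) \<longleftrightarrow> L (NotIn ts S) = TT"
| "models \<Sigma> L RTop \<longleftrightarrow> True"
| "models \<Sigma> L RBot \<longleftrightarrow> False"
| "models \<Sigma> L (RAnd c\<^sub>1 c\<^sub>2) \<longleftrightarrow> models \<Sigma> L c\<^sub>1 \<and> models \<Sigma> L c\<^sub>2"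
| "models \<Sigma> L (ROr c\<^sub>1 c\<^sub>2) \<longleftrightarrow> models \<Sigma> L c\<^sub>1 \<or> models \<Sigma> L c\<^sub>2"
| "models \<Sigma> L (REx x c) \<longleftrightarrow> (\<exists>t\<in>individuals \<Sigma>. models \<Sigma> L (rsubst [x \<mapsto> t] c))"
  by pat_completeness auto
termination
  by (relation "measure (\<lambda>(\<Sigma>, L, c). rdepth c)") auto


text \<open>The option type renders undefinedness.\<close>

type_synonym ('p, 'f, 'v) sat_fun =
  "('p, 'f, 'v) struct \<Rightarrow> ('p, 'f, 'v) atom \<Rightarrow> ('f, 'v) subst set option"

text \<open>The contract of \<open>sat\<close> at a single structure. It is not demanded of all structures at once: a
  finite answer set cannot exist in a structure where an atom with an output variable has
  infinitely many true instances.\<close>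

definition sat_correct_at ::
    "('f, 'p) sig \<Rightarrow> ('p, 'f, 'v) sat_fun \<Rightarrow> ('p, 'f, 'v) struct \<Rightarrow> bool" where
  "sat_correct_at \<Sigma> sat L \<longleftrightarrow>
    (\<forall>p ts. objective \<Sigma> p \<and> wf_atom \<Sigma> (Pred p ts) \<longrightarrow>
      (if \<forall>k\<in>inputs \<Sigma> p. tfv (ts ! k) = {}
       then \<exists>A. sat L (Pred p ts) = Some A \<and> finite A \<and>
              (\<forall>\<sigma>\<in>A. is_subst \<Sigma> \<sigma> \<and> (\<Union>j\<in>outputs \<Sigma> p. tfv (ts ! j)) \<subseteq> dom \<sigma>) \<and>
              (\<forall>\<sigma>'. is_subst \<Sigma> \<sigma>' \<and> afv (Pred p ts) \<subseteq> dom \<sigma>' \<longrightarrow>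
                 (L (asubst \<sigma>' (Pred p ts)) = TT \<longleftrightarrow> (\<exists>\<sigma>\<in>A. \<sigma> \<subseteq>\<^sub>m \<sigma>')))
       else sat L (Pred p ts) = None)) \<and>
    (\<forall>ts S. wf_atom \<Sigma> (NotIn ts S) \<longrightarrow>
      sat L (NotIn ts S) =
        (if \<forall>t\<in>set ts. tfv t = {} then Some (if ts \<notin> S then {Map.empty} else {}) else None))"

function sat_hat ::
    "('p, 'f, 'v) sat_fun \<Rightarrow> ('p, 'f, 'v) struct \<Rightarrow> ('p, 'f, 'v) restr \<Rightarrow> ('f, 'v) subst set option"
where
  "sat_hat sat L (RPred p ts) = sat L (Pred p ts)"
| "sat_hat sat L (RNotIn ts S) = sat L (NotIn ts S)"
| "sat_hat sat L RTop = Some {Map.empty}"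
| "sat_hat sat L RBot = Some {}"
| "sat_hat sat L (RAnd c\<^sub>1 c\<^sub>2) =
    (case sat_hat sat L c\<^sub>1 of
       None \<Rightarrow> None
     | Some A \<Rightarrow>
         if \<forall>\<sigma>\<^sub>1\<in>A. sat_hat sat L (rsubst \<sigma>\<^sub>1 c\<^sub>2) \<noteq> None
         then Some (\<Union>\<sigma>\<^sub>1\<in>A. subst_plus_set \<sigma>\<^sub>1 (the (sat_hat sat L (rsubst \<sigma>\<^sub>1 c\<^sub>2))))
         else None)"
| "sat_hat sat L (ROr c\<^sub>1 c\<^sub>2) =
    (case (sat_hat sat L c\<^sub>1, sat_hat sat L c\<^sub>2) of
       (Some A, Some B) \<Rightarrow> Some (A \<union> B)
     | _ \<Rightarrow> None)"
| "sat_hat sat L (REx x c) = map_option (\<lambda>A. subst_remove_set A x) (sat_hat sat L c)"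
  by pat_completeness auto
termination
  by (relation "measure (\<lambda>(sat, L, c). rdepth c)") auto

end

theory Submission
  imports Defs
begin

text \<open>By induction on the depth of the restriction, simultaneously with the fact that all answers are
  ground substitutions. For a conjunction, \<open>\<sigma>\<^sub>1 \<le> \<sigma>'\<close> gives \<open>c\<^sub>2\<sigma>\<^sub>1\<sigma>' = c\<^sub>2\<sigma>'\<close>, and answers below a common
  \<open>\<sigma>'\<close> agree on common variables, so their sum exists and lies below \<open>\<sigma>'\<close>. For \<open>\<exists>x. c\<close>, an answer
  \<open>\<sigma>\<close> of \<open>c\<close> with \<open>\<sigma> - {x} \<le> \<sigma>'\<close> yields the witness \<open>\<sigma>(x)\<close>, or any individual when \<open>x \<notin> dom \<sigma>\<close>,
  which is where the domain must be nonempty.\<close>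

section \<open>Composition and typing of ground substitutions\<close>

lemma tsubst_ground: "tfv t = {} \<Longrightarrow> tsubst \<sigma> t = t"
  by (induction t) (auto intro: map_idI)

text \<open>The terms inserted by \<open>\<sigma>\<close> are ground, so \<open>\<tau>\<close> acts
  only on variables outside \<open>dom \<sigma>\<close>. Hence the substitution applied first takes
  precedence and stands on the right of \<open>++\<close>.\<close>

lemma tsubst_tsubst:
  assumes "\<And>t. t \<in> ran \<sigma> \<Longrightarrow> tfv t = {}"
  shows "tsubst \<tau> (tsubst \<sigma> t) = tsubst (\<tau> ++ \<sigma>) t"
proof (induction t)
  case (Var x)
  then show ?case
    by (cases "\<sigma> x") (simp_all add: map_add_def tsubst_ground[OF assms[OF ranI]])
qed simp

lemma ran_upd_None: "ran (\<sigma>(x := None)) \<subseteq> ran \<sigma>"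
  by (auto simp: ran_def)

lemma rsubst_rsubst:
  assumes "\<And>t. t \<in> ran \<sigma> \<Longrightarrow> tfv t = {}"
  shows "rsubst \<tau> (rsubst \<sigma> c) = rsubst (\<tau> ++ \<sigma>) c"
  using assms
proof (induction c arbitrary: \<sigma> \<tau>)
  case (REx x c)
  \<comment> \<open>Passing the binder deletes \<open>x\<close> from both maps. This deletion
    commutes with \<open>++\<close> and can only shrink the range, so the induction hypothesis still
    applies.\<close>
  have "(\<tau> ++ \<sigma>)(x := None) = \<tau>(x := None) ++ \<sigma>(x := None)"
    by (auto simp: map_add_def fun_eq_iff split: option.split)
  moreover have "rsubst (\<tau>(x := None)) (rsubst (\<sigma>(x := None)) c) =
      rsubst (\<tau>(x := None) ++ \<sigma>(x := None)) c"
    by (rule REx.IH) (rule REx.prems[OF subsetD[OF ran_upd_None]])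
  ultimately show ?case by simp
qed (simp_all add: tsubst_tsubst)

lemma tfv_tsubst: "(\<And>t. t \<in> ran \<sigma> \<Longrightarrow> tfv t = {}) \<Longrightarrow> tfv (tsubst \<sigma> t) = tfv t - dom \<sigma>"
proof (induction t)
  case (Var x)
  then show ?case by (cases "\<sigma> x") (auto intro: ranI)
qed auto

lemma rfv_rsubst:
  "(\<And>t. t \<in> ran \<sigma> \<Longrightarrow> tfv t = {}) \<Longrightarrow> rfv (rsubst \<sigma> c) = rfv c - dom \<sigma>"
proof (induction c arbitrary: \<sigma>)
  case (REx x c)
  have "rfv (rsubst (\<sigma>(x := None)) c) = rfv c - dom (\<sigma>(x := None))"
    by (rule REx.IH) (rule REx.prems[OF subsetD[OF ran_upd_None]])
  then show ?case by auto
qed (auto simp: tfv_tsubst)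

lemma is_subst_ran: "is_subst \<Sigma> \<sigma> \<Longrightarrow> t \<in> ran \<sigma> \<Longrightarrow> tfv t = {}"
  by (auto simp: is_subst_def individuals_def)

lemma is_subst_upd_None: "is_subst \<Sigma> \<sigma> \<Longrightarrow> is_subst \<Sigma> (\<sigma>(x := None))"
  using ran_upd_None[of \<sigma> x] by (auto simp: is_subst_def)

lemma is_subst_upd: "is_subst \<Sigma> \<sigma> \<Longrightarrow> t \<in> individuals \<Sigma> \<Longrightarrow> is_subst \<Sigma> (\<sigma>(x \<mapsto> t))"
  by (auto simp: is_subst_def ran_def)

lemma ran_map_add_subset: "ran (\<sigma> ++ \<tau>) \<subseteq> ran \<sigma> \<union> ran \<tau>"
  unfolding ran_def by (auto simp: map_add_Some_iff)

lemma is_subst_add: "is_subst \<Sigma> \<sigma> \<Longrightarrow> is_subst \<Sigma> \<tau> \<Longrightarrow> is_subst \<Sigma> (\<sigma> ++ \<tau>)"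
  using ran_map_add_subset[of \<sigma> \<tau>] by (auto simp: is_subst_def)

lemma wf_trm_tsubst: "is_subst \<Sigma> \<sigma> \<Longrightarrow> wf_trm \<Sigma> t \<Longrightarrow> wf_trm \<Sigma> (tsubst \<sigma> t)"
proof (induction t)
  case (Var x)
  then show ?case
    by (cases "\<sigma> x") (auto simp: is_subst_def individuals_def ran_def)
qed auto

lemma restriction_rsubst: "is_subst \<Sigma> \<sigma> \<Longrightarrow> restriction \<Sigma> c \<Longrightarrow> restriction \<Sigma> (rsubst \<sigma> c)"
  by (induction c arbitrary: \<sigma>) (auto simp: wf_trm_tsubst is_subst_upd_None)

lemma map_add_absorb: "\<sigma> \<subseteq>\<^sub>m \<tau> \<Longrightarrow> \<tau> ++ \<sigma> = \<tau>"
  by (auto simp: map_le_def map_add_def fun_eq_iff dom_def split: option.splits)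

lemma rsubst_rsubst_le:
  assumes "is_subst \<Sigma> \<sigma>" "\<sigma> \<subseteq>\<^sub>m \<tau>"
  shows "rsubst \<tau> (rsubst \<sigma> c) = rsubst \<tau> c"
  using assms by (simp add: rsubst_rsubst is_subst_ran map_add_absorb)

text \<open>Serves the semantics of \<open>REx\<close>: the binder first drops \<open>x\<close> from
  \<open>\<sigma>\<close>, then the witness is put in. A single updated substitution is the form to
  which an induction hypothesis for the body applies.\<close>

lemma rsubst_upd:
  assumes "is_subst \<Sigma> \<sigma>"
  shows "rsubst [x \<mapsto> t] (rsubst (\<sigma>(x := None)) c) = rsubst (\<sigma>(x \<mapsto> t)) c"
proof -
  have "[x \<mapsto> t] ++ \<sigma>(x := None) = \<sigma>(x \<mapsto> t)"
    by (auto simp: map_add_def split: option.splits)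
  then show ?thesis
    by (simp only: rsubst_rsubst[OF is_subst_ran[OF is_subst_upd_None[OF assms]]])
qed

section \<open>Sums of substitutions and the extension order\<close>

lemma subst_plus_eq_SomeD:
  assumes "subst_plus \<sigma>\<^sub>1 \<sigma>\<^sub>2 = Some \<tau>"
  shows "\<tau> = \<sigma>\<^sub>1 ++ \<sigma>\<^sub>2" "\<sigma>\<^sub>1 \<subseteq>\<^sub>m \<tau>" "\<sigma>\<^sub>2 \<subseteq>\<^sub>m \<tau>"
proof -
  from assms have agree: "\<forall>x \<in> dom \<sigma>\<^sub>1 \<inter> dom \<sigma>\<^sub>2. \<sigma>\<^sub>1 x = \<sigma>\<^sub>2 x"
    and \<tau>: "\<tau> = \<sigma>\<^sub>1 ++ \<sigma>\<^sub>2"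
    unfolding subst_plus_def by (auto split: if_splits)
  show "\<tau> = \<sigma>\<^sub>1 ++ \<sigma>\<^sub>2" by (fact \<tau>)
  show "\<sigma>\<^sub>2 \<subseteq>\<^sub>m \<tau>" unfolding \<tau> by simp
  \<comment> \<open>On common variables \<open>++\<close> takes the value of the right summand; only
    \<open>agree\<close> keeps the left summand below the sum.\<close>
  show "\<sigma>\<^sub>1 \<subseteq>\<^sub>m \<tau>"
    unfolding \<tau> map_le_def using agree
    by (simp add: map_add_def domIff split: option.split)
qed

lemma subst_plus_of_le:
  assumes "\<sigma>\<^sub>1 \<subseteq>\<^sub>m \<tau>" "\<sigma>\<^sub>2 \<subseteq>\<^sub>m \<tau>"
  shows "subst_plus \<sigma>\<^sub>1 \<sigma>\<^sub>2 = Some (\<sigma>\<^sub>1 ++ \<sigma>\<^sub>2)" "\<sigma>\<^sub>1 ++ \<sigma>\<^sub>2 \<subseteq>\<^sub>m \<tau>"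
proof -
  have "\<sigma>\<^sub>1 x = \<sigma>\<^sub>2 x" if "x \<in> dom \<sigma>\<^sub>1 \<inter> dom \<sigma>\<^sub>2" for x
    using assms that by (metis IntE map_le_def)
  then show "subst_plus \<sigma>\<^sub>1 \<sigma>\<^sub>2 = Some (\<sigma>\<^sub>1 ++ \<sigma>\<^sub>2)"
    unfolding subst_plus_def by simp
  show "\<sigma>\<^sub>1 ++ \<sigma>\<^sub>2 \<subseteq>\<^sub>m \<tau>"
    using assms by (rule map_add_le_mapI)
qed

text \<open>A sum, when it exists, is the least upper bound of its summands, and a common upper
  bound \<open>\<tau>\<close> forces it to exist. So the partiality of \<open>subst_plus\<close>
  loses no answer below \<open>\<tau>\<close>.\<close>

lemma ex_subst_plus_set_le_iff:
  "(\<exists>\<sigma>\<in>subst_plus_set \<sigma>\<^sub>1 A. \<sigma> \<subseteq>\<^sub>m \<tau>) \<longleftrightarrow> \<sigma>\<^sub>1 \<subseteq>\<^sub>m \<tau> \<and> (\<exists>\<sigma>\<^sub>2\<in>A. \<sigma>\<^sub>2 \<subseteq>\<^sub>m \<tau>)"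
proof
  assume "\<exists>\<sigma>\<in>subst_plus_set \<sigma>\<^sub>1 A. \<sigma> \<subseteq>\<^sub>m \<tau>"
  then obtain \<sigma> \<sigma>\<^sub>2 where *: "\<sigma>\<^sub>2 \<in> A" "subst_plus \<sigma>\<^sub>1 \<sigma>\<^sub>2 = Some \<sigma>" "\<sigma> \<subseteq>\<^sub>m \<tau>"
    by (auto simp: subst_plus_set_def)
  show "\<sigma>\<^sub>1 \<subseteq>\<^sub>m \<tau> \<and> (\<exists>\<sigma>\<^sub>2\<in>A. \<sigma>\<^sub>2 \<subseteq>\<^sub>m \<tau>)"
    using subst_plus_eq_SomeD(2,3)[OF *(2), THEN map_le_trans, OF *(3)] *(1) by blast
next
  assume "\<sigma>\<^sub>1 \<subseteq>\<^sub>m \<tau> \<and> (\<exists>\<sigma>\<^sub>2\<in>A. \<sigma>\<^sub>2 \<subseteq>\<^sub>m \<tau>)"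
  then obtain \<sigma>\<^sub>2 where "\<sigma>\<^sub>1 \<subseteq>\<^sub>m \<tau>" "\<sigma>\<^sub>2 \<in> A" "\<sigma>\<^sub>2 \<subseteq>\<^sub>m \<tau>" by blast
  with subst_plus_of_le[of \<sigma>\<^sub>1 \<tau> \<sigma>\<^sub>2] show "\<exists>\<sigma>\<in>subst_plus_set \<sigma>\<^sub>1 A. \<sigma> \<subseteq>\<^sub>m \<tau>"
    unfolding subst_plus_set_def by blast
qed

section \<open>Answer sets of conjunctions and correctness of \<open>sat_hat\<close>\<close>

lemma sat_hat_RAnd_SomeD:
  assumes "sat_hat sat L (RAnd c\<^sub>1 c\<^sub>2) = Some A"
  shows "\<exists>A\<^sub>1 B. sat_hat sat L c\<^sub>1 = Some A\<^sub>1 \<and>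
    (\<forall>\<sigma>\<^sub>1\<in>A\<^sub>1. sat_hat sat L (rsubst \<sigma>\<^sub>1 c\<^sub>2) = Some (B \<sigma>\<^sub>1)) \<and>
    A = (\<Union>\<sigma>\<^sub>1\<in>A\<^sub>1. subst_plus_set \<sigma>\<^sub>1 (B \<sigma>\<^sub>1))"
  using assms
  by (intro exI[of _ "the (sat_hat sat L c\<^sub>1)"]
      exI[of _ "\<lambda>\<sigma>\<^sub>1. the (sat_hat sat L (rsubst \<sigma>\<^sub>1 c\<^sub>2))"])
    (auto split: option.splits if_splits)

text \<open>Structural induction would not reach \<open>rsubst \<sigma>\<^sub>1 c\<^sub>2\<close>,
  which is not a subformula but has the depth of \<open>c\<^sub>2\<close>. Groundness of answers is
  carried along because a conjunction applies them to its second conjunct and a quantifier takes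
  their value at \<open>x\<close> as a domain element.\<close>

lemma sat_hat_correct:
  assumes ne: "(individuals \<Sigma> :: ('f, 'v) trm set) \<noteq> {}"
    and ps: "partial_structure \<Sigma> (L :: ('p, 'f, 'v) struct)"
    and sc: "sat_correct_at \<Sigma> sat L"
  shows "restriction \<Sigma> c \<Longrightarrow> sat_hat sat L c = Some A \<Longrightarrow>
    (\<forall>\<sigma>\<in>A. is_subst \<Sigma> \<sigma>) \<and>
    (\<forall>\<sigma>'. is_subst \<Sigma> \<sigma>' \<and> rfv c \<subseteq> dom \<sigma>' \<longrightarrow>
       (models \<Sigma> L (rsubst \<sigma>' c) \<longleftrightarrow> (\<exists>\<sigma>\<in>A. \<sigma> \<subseteq>\<^sub>m \<sigma>')))"
proof (induction c arbitrary: A rule: measure_induct_rule[where f = rdepth])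
  case (less c)
  show ?case
  proof (cases c)
    case (RPred p ts)
    with less.prems have wf: "objective \<Sigma> p" "wf_atom \<Sigma> (Pred p ts)"
      and A: "sat L (Pred p ts) = Some A" by simp_all
    from sc wf have "if \<forall>k\<in>inputs \<Sigma> p. tfv (ts ! k) = {}
       then \<exists>A. sat L (Pred p ts) = Some A \<and> finite A \<and>
              (\<forall>\<sigma>\<in>A. is_subst \<Sigma> \<sigma> \<and> (\<Union>j\<in>outputs \<Sigma> p. tfv (ts ! j)) \<subseteq> dom \<sigma>) \<and>
              (\<forall>\<sigma>'. is_subst \<Sigma> \<sigma>' \<and> afv (Pred p ts) \<subseteq> dom \<sigma>' \<longrightarrow>
                 (L (asubst \<sigma>' (Pred p ts)) = TT \<longleftrightarrow> (\<exists>\<sigma>\<in>A. \<sigma> \<subseteq>\<^sub>m \<sigma>')))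
       else sat L (Pred p ts) = None"
      unfolding sat_correct_at_def by blast
    \<comment> \<open>Definedness rules out the branch with a non-ground input; the other branch
      gives the claim, since \<open>rsubst\<close> and \<open>asubst\<close> act alike on an
      atom.\<close>
    with A show ?thesis unfolding RPred by (auto split: if_splits)
  next
    case (RNotIn ts S)
    with less.prems have wf: "wf_atom \<Sigma> (NotIn ts S)"
      and A: "sat L (NotIn ts S) = Some A" by simp_all
    from sc wf have "sat L (NotIn ts S) =
        (if \<forall>t\<in>set ts. tfv t = {} then Some (if ts \<notin> S then {Map.empty} else {}) else None)"
      unfolding sat_correct_at_def by blast
    with A have gr: "\<forall>t\<in>set ts. tfv t = {}" and A: "A = (if ts \<notin> S then {Map.empty} else {})"
      by (auto split: if_splits)
    from ps wf gr have "L (NotIn ts S) = (if ts \<notin> S then TT else FF)"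
      unfolding partial_structure_def by simp
    \<comment> \<open>Being ground, the tuple is unchanged by every instance, so its truth does not
      depend on \<sigma>'. The answers match this: the empty substitution lies below every
      \<sigma>', and an empty answer set offers nothing.\<close>
    moreover from gr have "map (tsubst \<sigma>) ts = ts" for \<sigma>
      by (auto intro: map_idI tsubst_ground)
    ultimately show ?thesis using A RNotIn by (auto simp: is_subst_def)
  next
    case RTop
    with less.prems show ?thesis by (auto simp: is_subst_def)
  next
    case RBot
    with less.prems show ?thesis by auto
  next
    case (RAnd c\<^sub>1 c\<^sub>2)
    from less.prems RAnd have "restriction \<Sigma> c\<^sub>1" "restriction \<Sigma> c\<^sub>2" by simp_all
    from sat_hat_RAnd_SomeD[OF less.prems(2)[unfolded RAnd]]
    obtain A\<^sub>1 B where A\<^sub>1: "sat_hat sat L c\<^sub>1 = Some A\<^sub>1"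
      and B: "\<And>\<sigma>\<^sub>1. \<sigma>\<^sub>1 \<in> A\<^sub>1 \<Longrightarrow> sat_hat sat L (rsubst \<sigma>\<^sub>1 c\<^sub>2) = Some (B \<sigma>\<^sub>1)"
      and A: "A = (\<Union>\<sigma>\<^sub>1\<in>A\<^sub>1. subst_plus_set \<sigma>\<^sub>1 (B \<sigma>\<^sub>1))"
      by auto
    from less.IH[OF _ \<open>restriction \<Sigma> c\<^sub>1\<close> A\<^sub>1]
    have subst\<^sub>1: "is_subst \<Sigma> \<sigma>\<^sub>1" if "\<sigma>\<^sub>1 \<in> A\<^sub>1" for \<sigma>\<^sub>1
      using that by (simp add: RAnd)
    from less.IH[OF _ \<open>restriction \<Sigma> c\<^sub>1\<close> A\<^sub>1]
    have iff\<^sub>1: "models \<Sigma> L (rsubst \<sigma>' c\<^sub>1) \<longleftrightarrow> (\<exists>\<sigma>\<in>A\<^sub>1. \<sigma> \<subseteq>\<^sub>m \<sigma>')"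
      if "is_subst \<Sigma> \<sigma>'" "rfv c\<^sub>1 \<subseteq> dom \<sigma>'" for \<sigma>'
      using that by (simp add: RAnd)
    have IH\<^sub>2: "(\<forall>\<sigma>\<in>B \<sigma>\<^sub>1. is_subst \<Sigma> \<sigma>) \<and>
      (\<forall>\<sigma>'. is_subst \<Sigma> \<sigma>' \<and> rfv (rsubst \<sigma>\<^sub>1 c\<^sub>2) \<subseteq> dom \<sigma>' \<longrightarrow>
        (models \<Sigma> L (rsubst \<sigma>' (rsubst \<sigma>\<^sub>1 c\<^sub>2)) \<longleftrightarrow> (\<exists>\<sigma>\<in>B \<sigma>\<^sub>1. \<sigma> \<subseteq>\<^sub>m \<sigma>')))"
      if "\<sigma>\<^sub>1 \<in> A\<^sub>1" for \<sigma>\<^sub>1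
      using less.IH[OF _ restriction_rsubst[OF subst\<^sub>1[OF that] \<open>restriction \<Sigma> c\<^sub>2\<close>] B[OF that]]
      by (simp add: RAnd)
    have iff\<^sub>2: "models \<Sigma> L (rsubst \<sigma>' c\<^sub>2) \<longleftrightarrow> (\<exists>\<sigma>\<in>B \<sigma>\<^sub>1. \<sigma> \<subseteq>\<^sub>m \<sigma>')"
      if "\<sigma>\<^sub>1 \<in> A\<^sub>1" "\<sigma>\<^sub>1 \<subseteq>\<^sub>m \<sigma>'" "is_subst \<Sigma> \<sigma>'" "rfv c\<^sub>2 \<subseteq> dom \<sigma>'" for \<sigma>\<^sub>1 \<sigma>'
    proof -
      \<comment> \<open>Ground instantiation only removes free variables, so a domain covering
        \<open>c\<^sub>2\<close> also covers its instance.\<close>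
      have "rfv (rsubst \<sigma>\<^sub>1 c\<^sub>2) \<subseteq> dom \<sigma>'"
        using that(4) by (auto simp: rfv_rsubst is_subst_ran[OF subst\<^sub>1[OF that(1)]])
      with IH\<^sub>2[OF that(1)] that(3)
      have "models \<Sigma> L (rsubst \<sigma>' (rsubst \<sigma>\<^sub>1 c\<^sub>2)) \<longleftrightarrow> (\<exists>\<sigma>\<in>B \<sigma>\<^sub>1. \<sigma> \<subseteq>\<^sub>m \<sigma>')"
        by blast
      then show ?thesis by (simp add: rsubst_rsubst_le[OF subst\<^sub>1[OF that(1)] that(2)])
    qed
    have "is_subst \<Sigma> \<sigma>" if "\<sigma> \<in> A" for \<sigma>
      using that IH\<^sub>2 subst\<^sub>1 unfolding A
      by (auto simp: subst_plus_set_def is_subst_add dest!: subst_plus_eq_SomeD(1))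
    moreover have "models \<Sigma> L (rsubst \<sigma>' c) \<longleftrightarrow> (\<exists>\<sigma>\<in>A. \<sigma> \<subseteq>\<^sub>m \<sigma>')"
      if "is_subst \<Sigma> \<sigma>'" "rfv c \<subseteq> dom \<sigma>'" for \<sigma>'
    proof -
      have fv: "rfv c\<^sub>1 \<subseteq> dom \<sigma>'" "rfv c\<^sub>2 \<subseteq> dom \<sigma>'" using that(2) RAnd by auto
      \<comment> \<open>By \<open>iff\<^sub>2\<close>, the truth of \<open>c\<^sub>2\<close> under
        \<sigma>' can be tested at any answer of \<open>c\<^sub>1\<close> below \<sigma>', so the
        choice of that answer does not matter.\<close>
      have "models \<Sigma> L (rsubst \<sigma>' c) \<longleftrightarrow>
          (\<exists>\<sigma>\<^sub>1\<in>A\<^sub>1. \<sigma>\<^sub>1 \<subseteq>\<^sub>m \<sigma>' \<and> (\<exists>\<sigma>\<^sub>2\<in>B \<sigma>\<^sub>1. \<sigma>\<^sub>2 \<subseteq>\<^sub>m \<sigma>'))"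
        using iff\<^sub>1[OF that(1) fv(1)] iff\<^sub>2[OF _ _ that(1) fv(2)] by (auto simp: RAnd)
      also have "\<dots> \<longleftrightarrow> (\<exists>\<sigma>\<in>A. \<sigma> \<subseteq>\<^sub>m \<sigma>')"
        by (simp add: A ex_subst_plus_set_le_iff)
      finally show ?thesis .
    qed
    ultimately show ?thesis by blast
  next
    case (ROr c\<^sub>1 c\<^sub>2)
    with less.prems obtain A\<^sub>1 A\<^sub>2 where "restriction \<Sigma> c\<^sub>1" "restriction \<Sigma> c\<^sub>2"
      "sat_hat sat L c\<^sub>1 = Some A\<^sub>1" "sat_hat sat L c\<^sub>2 = Some A\<^sub>2" "A = A\<^sub>1 \<union> A\<^sub>2"
      by (auto split: option.splits)
    with less.IH[of c\<^sub>1 A\<^sub>1] less.IH[of c\<^sub>2 A\<^sub>2] show ?thesis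
      by (simp add: ROr) blast
  next
    case (REx x d)
    with less.prems obtain B where B: "restriction \<Sigma> d" "sat_hat sat L d = Some B"
      and A: "A = (\<lambda>\<sigma>. \<sigma>(x := None)) ` B"
      by (auto simp: subst_remove_set_def)
    from less.IH[OF _ B] have subst: "is_subst \<Sigma> \<sigma>" if "\<sigma> \<in> B" for \<sigma>
      using that by (simp add: REx)
    from less.IH[OF _ B] have iff: "models \<Sigma> L (rsubst \<sigma>' d) \<longleftrightarrow> (\<exists>\<sigma>\<in>B. \<sigma> \<subseteq>\<^sub>m \<sigma>')"
      if "is_subst \<Sigma> \<sigma>'" "rfv d \<subseteq> dom \<sigma>'" for \<sigma>'
      using that by (simp add: REx)
    have "models \<Sigma> L (rsubst \<sigma>' c) \<longleftrightarrow> (\<exists>\<sigma>\<in>A. \<sigma> \<subseteq>\<^sub>m \<sigma>')"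
      if \<sigma>': "is_subst \<Sigma> \<sigma>'" "rfv c \<subseteq> dom \<sigma>'" for \<sigma>'
    proof -
      have "models \<Sigma> L (rsubst \<sigma>' c) \<longleftrightarrow>
          (\<exists>t\<in>individuals \<Sigma>. models \<Sigma> L (rsubst (\<sigma>'(x \<mapsto> t)) d))"
        by (simp add: REx rsubst_upd[OF \<sigma>'(1)])
      also have "\<dots> \<longleftrightarrow> (\<exists>t\<in>individuals \<Sigma>. \<exists>\<sigma>\<in>B. \<sigma> \<subseteq>\<^sub>m \<sigma>'(x \<mapsto> t))"
      proof (rule bex_cong[OF refl])
        fix t :: "('f, 'v) trm" assume "t \<in> individuals \<Sigma>"
        moreover have "rfv d \<subseteq> dom (\<sigma>'(x \<mapsto> t))" using \<sigma>'(2) by (auto simp: REx)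
        ultimately show "models \<Sigma> L (rsubst (\<sigma>'(x \<mapsto> t)) d) \<longleftrightarrow> (\<exists>\<sigma>\<in>B. \<sigma> \<subseteq>\<^sub>m \<sigma>'(x \<mapsto> t))"
          using \<sigma>'(1) by (intro iff is_subst_upd)
      qed
      also have "\<dots> \<longleftrightarrow> (\<exists>\<sigma>\<in>B. \<sigma>(x := None) \<subseteq>\<^sub>m \<sigma>')"
      proof -
        \<comment> \<open>The existentials over \<open>t\<close> and \<sigma> commute, so it
          suffices to decide for one fixed answer whether some value at \<open>x\<close> fits
          it.\<close>
        have "(\<exists>t\<in>individuals \<Sigma>. \<sigma> \<subseteq>\<^sub>m \<sigma>'(x \<mapsto> t)) \<longleftrightarrow> \<sigma>(x := None) \<subseteq>\<^sub>m \<sigma>'"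
          if "\<sigma> \<in> B" for \<sigma>
        proof (cases "\<sigma> x")
          case None
          then have "\<sigma>(x := None) = \<sigma>" by auto
          moreover from None have "\<sigma> \<subseteq>\<^sub>m \<sigma>'(x \<mapsto> t) \<longleftrightarrow> \<sigma> \<subseteq>\<^sub>m \<sigma>'" for t
            by (auto simp: map_le_def domIff)
          moreover from ne obtain t :: "('f, 'v) trm" where "t \<in> individuals \<Sigma>" by blast
          ultimately show ?thesis by auto
        next
          case (Some u)
          \<comment> \<open>Comparison at \<open>x\<close> forces \<open>t = u\<close>, so the
            equivalence needs \<open>u\<close> to be an individual; groundness of answers supplies
            this.\<close>
          then have "u \<in> individuals \<Sigma>"
            using subst[OF that] by (auto simp: is_subst_def ran_def)
          with Some show ?thesis by (auto simp: map_le_def dom_def)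
        qed
        then show ?thesis by blast
      qed
      also have "\<dots> \<longleftrightarrow> (\<exists>\<sigma>\<in>A. \<sigma> \<subseteq>\<^sub>m \<sigma>')" by (simp add: A)
      finally show ?thesis .
    qed
    with subst show ?thesis by (auto simp: A is_subst_upd_None)
  qed
qed

theorem mainTheorem3:
  fixes \<Sigma> :: "('f, 'p) sig"
    and L :: "('p, 'f, 'v) struct"
    and sat :: "('p, 'f, 'v) sat_fun"
    and c :: "('p, 'f, 'v) restr"
    and A :: "('f, 'v) subst set"
  assumes "wf_sig \<Sigma>"
    and "(individuals \<Sigma> :: ('f, 'v) trm set) \<noteq> {}"
    and "partial_structure \<Sigma> L"
    and "sat_correct_at \<Sigma> sat L"
    and "restriction \<Sigma> c"
    and "sat_hat sat L c = Some A"
  shows "\<forall>\<sigma>'. is_subst \<Sigma> \<sigma>' \<and> rfv c \<subseteq> dom \<sigma>' \<longrightarrow>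
           (models \<Sigma> L (rsubst \<sigma>' c) \<longleftrightarrow> (\<exists>\<sigma>\<in>A. \<sigma> \<subseteq>\<^sub>m \<sigma>'))"
  using sat_hat_correct[OF assms(2-6)] by blast

end
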